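(* Let $k\in\mathbb{Z}_{\ge0}$ and let $\alpha$ be a partition with $\ell(\alpha)\le k$. Then for all partitions $\mu,\nu$, $$C'_{\alpha,\alpha,k}(\mu,\nu)=\begin{cases}1&\text{if }\mu=\emptyset\text{ and }\alpha=\nu,\\0&\text{otherwise.}\end{cases}$$
   Context: Partitions are identified with their Young diagrams (English notation). $\mu'$ is the conjugate (transpose) of $\mu$, $\ell(\mu)$ its number of nonzero rows, and $\emptyset$ the empty partition. The rank $r(\mu)$ is the greatest integer $k\ge 0$ with $\mu_k\ge k$ (side length of the Durfee square; $r(\emptyset)=0$). The $k$-stabilization $\mu_{(k)}$ is the partition obtained from $\mu$ by adding $k$ rows of length $r(\mu)$ (inserted so that the rows remain weakly decreasing). For partitions $\nu\subseteq\alpha$, a tableau of skew shape $\alpha/\nu$ is a filling of the boxes of $\alpha$ not in $\nu$ with positive integers; it is semistandard if rows weakly increase left to right and columns strictly increase top to bottom. Its content is $(c_1,c_2,\dots)$ with $c_i$ the number of labels equal to $i$. Its reverse reading word is obtained by reading the rows right to left, from top to bottom. A word is lattice if for every $i\ge1$ each initial segment contains at least as many $i$'s as $(i+1)$'s. A Littlewood--Richardson tableau is a semistandard tableau whose reverse reading word is lattice. $\mathrm{LR}(\alpha/\nu,\lambda)$ denotes the set of Littlewood--Richardson tableaux of shape $\alpha/\nu$ and content $\lambda$ (empty if $\nu\not\subseteq\alpha$), and $c^{\alpha}_{\nu,\lambda}=|\mathrm{LR}(\alpha/\nu,\lambda)|$. For partitions $\alpha,\beta$ with $|\alpha|=|\beta|$,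 define $C'_{\alpha,\beta,k}(\mu,\nu)=c^{\alpha}_{\nu,\mu_{(k)}}\,c^{\beta}_{\nu,(\mu')_{(k)}}$. *)

theory Defs
  imports Main "HOL-Library.FuncSet"
begin

text \<open>
  A partition is the weakly decreasing list of its nonzero rows, so that equal partitions are
  equal lists and \<^term>\<open>length \<mu>\<close> is the number of nonzero rows. Rows, columns and
  boxes are numbered from 1, in English notation (row 1 on top).
\<close>

definition is_partition :: "nat list \<Rightarrow> bool" where
  "is_partition \<mu> \<longleftrightarrow> sorted_wrt (\<ge>) \<mu> \<and> (\<forall>x\<in>set \<mu>. 0 < x)"

definition part_row :: "nat list \<Rightarrow> nat \<Rightarrow> nat" where
  "part_row \<mu> i = (if 1 \<le> i \<and> i \<le> length \<mu> then \<mu> ! (i - 1) else 0)"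

definition diagram :: "nat list \<Rightarrow> (nat \<times> nat) set" where
  "diagram \<mu> = {(i, j). 1 \<le> i \<and> 1 \<le> j \<and> j \<le> part_row \<mu> i}"

definition conjugate :: "nat list \<Rightarrow> nat list" where
  "conjugate \<mu> = map (\<lambda>j. card {i. (i, j) \<in> diagram \<mu>}) [1..<Suc (part_row \<mu> 1)]"

text \<open>The index 0 always qualifies in the following definition, as \<^term>\<open>part_row \<mu> 0 = 0\<close>.\<close>

definition part_rank :: "nat list \<Rightarrow> nat" where
  "part_rank \<mu> = (GREATEST k. k \<le> part_row \<mu> k)"

text \<open>
  The filter only matters for the empty partition, whose rank is 0: there the \<open>k\<close> added rows
  are empty and have to be dropped from the list of nonzero rows.
\<close>

definition stabilization :: "nat \<Rightarrow> nat list \<Rightarrow> nat list" where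
  "stabilization k \<mu> = rev (sort (filter (\<lambda>x. 0 < x) (\<mu> @ replicate k (part_rank \<mu>))))"

definition skew_shape :: "nat list \<Rightarrow> nat list \<Rightarrow> (nat \<times> nat) set" where
  "skew_shape \<alpha> \<nu> = diagram \<alpha> - diagram \<nu>"

text \<open>
  Fillings are extensional functions on the boxes, so that distinct functions are
  distinct tableaux and cardinalities of sets of tableaux are the intended ones.
\<close>

definition is_tableau :: "nat list \<Rightarrow> nat list \<Rightarrow> (nat \<times> nat \<Rightarrow> nat) \<Rightarrow> bool" where
  "is_tableau \<alpha> \<nu> T \<longleftrightarrow> T \<in> skew_shape \<alpha> \<nu> \<rightarrow>\<^sub>E {1..}"

definition semistandard :: "nat list \<Rightarrow> nat list \<Rightarrow> (nat \<times> nat \<Rightarrow> nat) \<Rightarrow> bool" where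
  "semistandard \<alpha> \<nu> T \<longleftrightarrow>
     (\<forall>i j j'. (i, j) \<in> skew_shape \<alpha> \<nu> \<and> (i, j') \<in> skew_shape \<alpha> \<nu> \<and> j < j'
        \<longrightarrow> T (i, j) \<le> T (i, j')) \<and>
     (\<forall>i i' j. (i, j) \<in> skew_shape \<alpha> \<nu> \<and> (i', j) \<in> skew_shape \<alpha> \<nu> \<and> i < i'
        \<longrightarrow> T (i, j) < T (i', j))"

definition tableau_content ::
    "nat list \<Rightarrow> nat list \<Rightarrow> (nat \<times> nat \<Rightarrow> nat) \<Rightarrow> nat \<Rightarrow> nat" where
  "tableau_content \<alpha> \<nu> T i = card {b \<in> skew_shape \<alpha> \<nu>. T b = i}"

text \<open>For \<open>\<nu> \<subseteq> \<alpha>\<close>, row \<open>i\<close> of the skew shape consists of the columns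
  \<open>\<nu>\<^sub>i + 1, \<dots>, \<alpha>\<^sub>i\<close>.\<close>

definition reverse_reading_word ::
    "nat list \<Rightarrow> nat list \<Rightarrow> (nat \<times> nat \<Rightarrow> nat) \<Rightarrow> nat list" where
  "reverse_reading_word \<alpha> \<nu> T =
     concat (map (\<lambda>i. map (\<lambda>j. T (i, j)) (rev [Suc (part_row \<nu> i)..<Suc (part_row \<alpha> i)]))
       [1..<Suc (length \<alpha>)])"

definition lattice_word :: "nat list \<Rightarrow> bool" where
  "lattice_word w \<longleftrightarrow>
     (\<forall>i\<ge>1. \<forall>n\<le>length w. count_list (take n w) (Suc i) \<le> count_list (take n w) i)"

definition LR_tableaux ::
    "nat list \<Rightarrow> nat list \<Rightarrow> nat list \<Rightarrow> (nat \<times> nat \<Rightarrow> nat) set" where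
  "LR_tableaux \<alpha> \<nu> l =
     (if diagram \<nu> \<subseteq> diagram \<alpha> then
        {T. is_tableau \<alpha> \<nu> T \<and> semistandard \<alpha> \<nu> T \<and>
            lattice_word (reverse_reading_word \<alpha> \<nu> T) \<and>
            (\<forall>i\<ge>1. tableau_content \<alpha> \<nu> T i = part_row l i)}
      else {})"

definition LR_coeff :: "nat list \<Rightarrow> nat list \<Rightarrow> nat list \<Rightarrow> nat" where
  "LR_coeff \<alpha> \<nu> l = card (LR_tableaux \<alpha> \<nu> l)"

text \<open>This is \<open>C'\<^sub>\<alpha>\<^sub>,\<^sub>\<beta>\<^sub>,\<^sub>k(\<mu>, \<nu>)\<close>, meant for partitions \<open>\<alpha>\<close>, \<open>\<beta>\<close> of the same size.\<close>

definition C' :: "nat list \<Rightarrow> nat list \<Rightarrow> nat \<Rightarrow> nat list \<Rightarrow> nat list \<Rightarrow> nat" where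
  "C' \<alpha> \<beta> k \<mu> \<nu> =
     LR_coeff \<alpha> \<nu> (stabilization k \<mu>) * LR_coeff \<beta> \<nu> (stabilization k (conjugate \<mu>))"

end

theory Submission
  imports Defs
begin

text \<open>
  In a Littlewood--Richardson tableau the labels of row \<open>i\<close> are at most \<open>i\<close>, so the content of such
  a tableau of shape \<open>\<alpha>/\<nu>\<close> has at most \<open>\<ell>(\<alpha>)\<close> rows. If \<open>\<mu>\<close> is nonempty, its rank is positive and
  \<open>\<mu>\<^sub>(\<^sub>k\<^sub>)\<close> has \<open>\<ell>(\<mu>) + k > \<ell>(\<alpha>)\<close> rows, so already the first factor vanishes. If \<open>\<mu>\<close> is empty, both
  contents are empty, which leaves only the empty tableau of shape \<open>\<alpha>/\<alpha>\<close>.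
\<close>

lemma mem_skew_shape_iff:
  "(i, j) \<in> skew_shape \<alpha> \<nu> \<longleftrightarrow> 1 \<le> i \<and> part_row \<nu> i < j \<and> j \<le> part_row \<alpha> i"
  by (auto simp: skew_shape_def diagram_def)

lemma part_row_pos_imp: "0 < part_row \<mu> i \<Longrightarrow> 1 \<le> i \<and> i \<le> length \<mu>"
  by (auto simp: part_row_def split: if_splits)

lemma part_row_pos_iff:
  assumes "is_partition \<mu>"
  shows "0 < part_row \<mu> i \<longleftrightarrow> 1 \<le> i \<and> i \<le> length \<mu>"
  using assms by (auto simp: part_row_def is_partition_def)

text \<open>\<open>card\<close> is also 0 on infinite sets, so finiteness is what lets a vanishing
  content exclude a label.\<close>

lemma finite_skew_shape: "finite (skew_shape \<alpha> \<nu>)"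
proof (rule finite_subset)
  show "skew_shape \<alpha> \<nu> \<subseteq> (SIGMA i:{1..length \<alpha>}. {..part_row \<alpha> i})"
    using part_row_pos_imp by (force simp: mem_skew_shape_iff)
qed simp

lemma diagram_inject:
  assumes "is_partition \<mu>" "is_partition \<nu>" "diagram \<mu> = diagram \<nu>"
  shows "\<mu> = \<nu>"
proof -
  have rows: "part_row \<mu> i = part_row \<nu> i" for i
  proof (cases "i = 0")
    case False
    have "(i, j) \<in> diagram \<mu> \<longleftrightarrow> (i, j) \<in> diagram \<nu>" for j
      using assms(3) by simp
    \<comment> \<open>The last box of row \<open>i\<close> of either diagram lies in the other one,
      which gives both inequalities.\<close>
    from this[of "part_row \<mu> i"] this[of "part_row \<nu> i"] show ?thesis
      using False by (auto simp: diagram_def)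
  qed (simp add: part_row_def)
  have "1 \<le> i \<and> i \<le> length \<mu> \<longleftrightarrow> 1 \<le> i \<and> i \<le> length \<nu>" for i
    using rows part_row_pos_iff assms(1,2) by metis
  from this[of "length \<mu>"] this[of "length \<nu>"] have len: "length \<mu> = length \<nu>"
    by (cases \<mu>; cases \<nu>) auto
  show ?thesis
  proof (rule nth_equalityI[OF len])
    fix i assume "i < length \<mu>"
    with rows[of "Suc i"] len show "\<mu> ! i = \<nu> ! i"
      by (simp add: part_row_def)
  qed
qed

text \<open>The lattice condition enters only in this form: a positive count of \<open>Suc i\<close>
  in a prefix forces a positive count of \<open>i\<close>.\<close>

lemma lattice_word_prefix:
  assumes "lattice_word (u @ v)" "1 \<le> i" "Suc i \<in> set u"
  shows "i \<in> set u"
proof -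
  have "count_list u (Suc i) \<le> count_list u i"
    using assms(1,2) unfolding lattice_word_def
    by (metis append_eq_conv_conj le_add1 length_append)
  moreover have "count_list u (Suc i) \<noteq> 0"
    using assms(3) by (simp add: count_list_0_iff)
  ultimately show ?thesis
    by (metis count_list_0_iff le_zero_eq)
qed

text \<open>Cutting the word right after the letter of box \<open>(i, j)\<close> turns the lattice
  condition into a statement about the boxes read so far.\<close>

lemma reverse_reading_word_split:
  assumes "(i, j) \<in> skew_shape \<alpha> \<nu>"
  obtains u v where "reverse_reading_word \<alpha> \<nu> T = u @ v"
    and "set u = T ` {(i', j') \<in> skew_shape \<alpha> \<nu>. i' < i \<or> i' = i \<and> j \<le> j'}"
proof -
  define R where "R i = map (\<lambda>j. T (i, j)) (rev [Suc (part_row \<nu> i)..<Suc (part_row \<alpha> i)])" for i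
  define S where "S js = map (\<lambda>j. T (i, j)) (rev js)" for js
  have ij: "1 \<le> i" "i \<le> length \<alpha>" "part_row \<nu> i < j" "j \<le> part_row \<alpha> i"
    using assms part_row_pos_imp[of \<alpha> i] by (auto simp: mem_skew_shape_iff)
  have "[1..<Suc (length \<alpha>)] = [1..<i] @ i # [Suc i..<Suc (length \<alpha>)]"
    using ij upt_add_eq_append[of 1 i "Suc (length \<alpha>) - i"] upt_conv_Cons[of i "Suc (length \<alpha>)"]
    by (simp del: upt_Suc)
  \<comment> \<open>Rows are read from right to left, so the columns from \<open>j\<close> on come
    before those to the left of \<open>j\<close>.\<close>
  moreover have "R i = S [j..<Suc (part_row \<alpha> i)] @ S [Suc (part_row \<nu> i)..<j]"
    using ij upt_add_eq_append[of "Suc (part_row \<nu> i)" j "Suc (part_row \<alpha> i) - j"]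
    by (simp add: R_def S_def del: upt_Suc flip: map_append rev_append)
  ultimately have "reverse_reading_word \<alpha> \<nu> T =
      (concat (map R [1..<i]) @ S [j..<Suc (part_row \<alpha> i)]) @
      (S [Suc (part_row \<nu> i)..<j] @ concat (map R [Suc i..<Suc (length \<alpha>)]))"
    by (simp add: reverse_reading_word_def R_def[symmetric] del: upt_Suc)
  moreover have "set (concat (map R [1..<i]) @ S [j..<Suc (part_row \<alpha> i)]) =
      T ` {(i', j') \<in> skew_shape \<alpha> \<nu>. i' < i \<or> i' = i \<and> j \<le> j'}"
  proof -
    have "{(i', j') \<in> skew_shape \<alpha> \<nu>. i' < i \<or> i' = i \<and> j \<le> j'} =
        (SIGMA i':{1..<i}. {Suc (part_row \<nu> i')..<Suc (part_row \<alpha> i')}) \<union>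
        {i} \<times> {j..<Suc (part_row \<alpha> i)}" (is "?A = ?B")
      using ij by (auto simp: mem_skew_shape_iff)
    moreover have "set (concat (map R [1..<i]) @ S [j..<Suc (part_row \<alpha> i)]) = T ` ?B"
      unfolding R_def S_def image_Un by (auto simp del: upt_Suc)
    ultimately show ?thesis by simp
  qed
  ultimately show thesis
    by (rule that)
qed

text \<open>Strong induction on the row. A label \<open>Suc m\<close> in row \<open>i\<close> with
  \<open>m\<close> at least \<open>i\<close> requires an \<open>m\<close> read earlier. In a higher
  row that \<open>m\<close> violates the induction hypothesis; in row \<open>i\<close>, weakly to
  the right, it violates the weak increase of the row.\<close>

lemma LR_label_le_row:
  assumes ss: "semistandard \<alpha> \<nu> T" and lat: "lattice_word (reverse_reading_word \<alpha> \<nu> T)"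
  shows "(i, j) \<in> skew_shape \<alpha> \<nu> \<Longrightarrow> T (i, j) \<le> i"
proof (induction i arbitrary: j rule: less_induct)
  case (less i)
  have "1 \<le> i"
    using less.prems by (simp add: mem_skew_shape_iff)
  show ?case
  proof (rule ccontr)
    assume "\<not> T (i, j) \<le> i"
    then obtain m where m: "T (i, j) = Suc m" "i \<le> m"
      by (metis Suc_le_D Suc_le_mono not_less_eq_eq)
    obtain u v where word: "reverse_reading_word \<alpha> \<nu> T = u @ v"
      and u: "set u = T ` {(i', j') \<in> skew_shape \<alpha> \<nu>. i' < i \<or> i' = i \<and> j \<le> j'}"
      using reverse_reading_word_split[OF less.prems] .
    have "Suc m \<in> set u"
      using u m(1) less.prems by force
    \<comment> \<open>The lattice condition concerns positive letters only; here \<open>m\<close> is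
      at least \<open>i\<close>, hence at least 1.\<close>
    then have "m \<in> set u"
      using lattice_word_prefix[of u v m] lat word \<open>1 \<le> i\<close> m(2) by simp
    then obtain i' j' where T': "T (i', j') = m" "(i', j') \<in> skew_shape \<alpha> \<nu>"
      and "i' < i \<or> i' = i \<and> j \<le> j'"
      using u by auto
    then consider "i' < i" | "i' = i" "j \<le> j'"
      by blast
    then show False
    proof cases
      case 1
      with less.IH T' m(2) show ?thesis by fastforce
    next
      case 2
      then have "T (i, j) \<le> T (i, j')"
        using ss T' less.prems unfolding semistandard_def by (cases "j = j'") auto
      with 2 T' m(1) show ?thesis by simp
    qed
  qed
qed

text \<open>The last part of \<open>l\<close> is positive, so the label \<open>length l\<close>
  occurs in some box; the row of that box is at least \<open>length l\<close> and at most
  \<open>length \<alpha>\<close>.\<close>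

lemma LR_content_length:
  assumes "T \<in> LR_tableaux \<alpha> \<nu> l" "\<forall>x\<in>set l. 0 < x"
  shows "length l \<le> length \<alpha>"
proof (cases "l = []")
  case False
  have T: "semistandard \<alpha> \<nu> T" "lattice_word (reverse_reading_word \<alpha> \<nu> T)"
    "\<forall>i\<ge>1. tableau_content \<alpha> \<nu> T i = part_row l i"
    using assms(1) by (auto simp: LR_tableaux_def split: if_splits)
  have "0 < part_row l (length l)"
    using False assms(2) by (auto simp: part_row_def Suc_le_eq)
  then have "{b \<in> skew_shape \<alpha> \<nu>. T b = length l} \<noteq> {}"
    using T(3)[rule_format, of "length l"] part_row_pos_imp[of l "length l"]
    unfolding tableau_content_def by (metis card.empty less_irrefl)
  then obtain i j where ij: "(i, j) \<in> skew_shape \<alpha> \<nu>" "T (i, j) = length l"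
    by auto
  then have "length l \<le> i"
    using LR_label_le_row[OF T(1,2)] by fastforce
  also have "i \<le> length \<alpha>"
    using ij(1) part_row_pos_imp[of \<alpha> i] by (auto simp: mem_skew_shape_iff)
  finally show ?thesis .
qed simp

lemma part_rank_Nil: "part_rank [] = 0"
  unfolding part_rank_def by (rule Greatest_equality) (auto simp: part_row_def split: if_splits)

lemma part_rank_pos:
  assumes "is_partition \<mu>" "\<mu> \<noteq> []"
  shows "0 < part_rank \<mu>"
proof -
  have "1 \<le> part_row \<mu> 1"
    using assms part_row_pos_iff[of \<mu> 1] by (simp add: Suc_le_eq)
  \<comment> \<open>\<open>GREATEST\<close> can be compared with a candidate only once the
    candidates are known to be bounded.\<close>
  moreover have "i \<le> length \<mu>" if "i \<le> part_row \<mu> i" for i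
    using that part_row_pos_imp[of \<mu> i] by (cases "i = 0") auto
  ultimately have "1 \<le> part_rank \<mu>"
    unfolding part_rank_def by (rule Greatest_le_nat)
  then show ?thesis by simp
qed

lemma stabilization_Nil: "stabilization k [] = []"
  by (simp add: stabilization_def part_rank_Nil)

lemma stabilization_pos: "x \<in> set (stabilization k \<mu>) \<Longrightarrow> 0 < x"
  by (auto simp: stabilization_def)

text \<open>Since the rank is positive, the \<open>k\<close> added rows are nonzero and the filter
  removes nothing.\<close>

lemma length_stabilization:
  assumes "is_partition \<mu>" "\<mu> \<noteq> []"
  shows "length (stabilization k \<mu>) = length \<mu> + k"
proof -
  have "filter (\<lambda>x. 0 < x) (\<mu> @ replicate k (part_rank \<mu>)) = \<mu> @ replicate k (part_rank \<mu>)"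
    using assms part_rank_pos[OF assms] by (intro filter_True) (auto simp: is_partition_def)
  then show ?thesis
    by (simp add: stabilization_def)
qed

lemma LR_coeff_eq_0_if_long:
  assumes "\<forall>x\<in>set l. 0 < x" "length \<alpha> < length l"
  shows "LR_coeff \<alpha> \<nu> l = 0"
proof -
  have "LR_tableaux \<alpha> \<nu> l = {}"
    using LR_content_length assms by (metis ex_in_conv leD)
  then show ?thesis
    by (simp add: LR_coeff_def)
qed

text \<open>Labels are positive, so zero content leaves no box to fill. Together with the inclusion
  of diagrams this forces equal shapes.\<close>

lemma LR_coeff_Nil:
  assumes "is_partition \<alpha>" "is_partition \<nu>"
  shows "LR_coeff \<alpha> \<nu> [] = (if \<alpha> = \<nu> then 1 else 0)"
proof (cases "\<alpha> = \<nu>")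
  case True
  have "skew_shape \<alpha> \<alpha> = {}" "reverse_reading_word \<alpha> \<alpha> T = []" for T
    by (auto simp: skew_shape_def reverse_reading_word_def simp del: upt_Suc)
  \<comment> \<open>Fillings are extensional, so the only one on the empty set of boxes is
    constantly \<open>undefined\<close>.\<close>
  then have "LR_tableaux \<alpha> \<alpha> [] = {\<lambda>_. undefined}"
    by (auto simp: LR_tableaux_def is_tableau_def semistandard_def lattice_word_def
        tableau_content_def part_row_def)
  with True show ?thesis
    by (simp add: LR_coeff_def)
next
  case False
  have "LR_tableaux \<alpha> \<nu> [] = {}"
  proof (rule equals0I)
    fix T assume "T \<in> LR_tableaux \<alpha> \<nu> []"
    then have sub: "diagram \<nu> \<subseteq> diagram \<alpha>" and T: "T \<in> skew_shape \<alpha> \<nu> \<rightarrow>\<^sub>E {1..}"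
      and content: "\<forall>i\<ge>1. tableau_content \<alpha> \<nu> T i = 0"
      by (auto simp: LR_tableaux_def is_tableau_def part_row_def split: if_splits)
    have "b \<notin> skew_shape \<alpha> \<nu>" for b
    proof
      assume b: "b \<in> skew_shape \<alpha> \<nu>"
      then have "1 \<le> T b"
        using T by auto
      then have "{c \<in> skew_shape \<alpha> \<nu>. T c = T b} = {}"
        using content finite_skew_shape[of \<alpha> \<nu>] by (simp add: tableau_content_def)
      with b show False by blast
    qed
    with sub have "diagram \<alpha> = diagram \<nu>"
      by (auto simp: skew_shape_def)
    with assms False show False
      using diagram_inject by blast
  qed
  with False show ?thesis
    by (simp add: LR_coeff_def)
qed

theorem proposition5p4:
  fixes k :: nat and \<alpha> \<mu> \<nu> :: "nat list"
  assumes "is_partition \<alpha>" and "length \<alpha> \<le> k"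
    and "is_partition \<mu>" and "is_partition \<nu>"
  shows "C' \<alpha> \<alpha> k \<mu> \<nu> = (if \<mu> = [] \<and> \<alpha> = \<nu> then 1 else 0)"
proof (cases "\<mu> = []")
  case True
  have "conjugate [] = []"
    by (simp add: conjugate_def part_row_def)
  with True show ?thesis
    using LR_coeff_Nil assms by (simp add: C'_def stabilization_Nil)
next
  case False
  then have "length \<alpha> < length (stabilization k \<mu>)"
    using assms length_stabilization[of \<mu> k] by (cases \<mu>) auto
  then have "LR_coeff \<alpha> \<nu> (stabilization k \<mu>) = 0"
    using stabilization_pos by (intro LR_coeff_eq_0_if_long) blast+
  with False show ?thesis
    by (simp add: C'_def)
qed

end
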